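(* Let $\lambda>-1/2$, $\lambda\neq1/2$. For $z>0$ let $\gamma_n=\gamma_n(z)$ be the coefficients of the recurrence $xP_n=P_{n+1}+\gamma_nP_{n-1}$ satisfied by the monic polynomials orthogonal with respect to the weight $(1-x^2)^{\lambda-1/2}e^{-zx^2}$ on $(-1,1)$, with $\gamma_0=0$, and set $$g_n(z)=\frac n2+\frac\lambda2-\frac14-z\gamma_n(z),\qquad n\ge0.$$ Then the function $g_n=g_n(z)$ satisfies $$\frac2z\left(2g_n-z\right)^2\left[\left(n+\lambda-\frac12-2g_n\right)\left(4g_n^2-\left(\lambda-\frac12\right)^2\right)+2z\left(g_n'\right)^2\right]=\left[4g_n\left(3g_n-n-\lambda+\frac12\right)-\left(\lambda-\frac12\right)^2-2z\,g_n''-g_n'\right]^2,$$ where $'$ denotes differentiation with respect to $z$.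
   Context: The monic orthogonal polynomials satisfy $\deg P_n=n$ and $\int_{-1}^1P_nP_m(1-x^2)^{\lambda-1/2}e^{-zx^2}dx=0$ for $n\ne m$; since the weight is even, the recurrence has the stated form for $n\ge0$ with $P_{-1}=0$, $P_0=1$. The parameter $\lambda$ is fixed. *)

theory Defs
  imports "HOL-Analysis.Analysis" "HOL-Computational_Algebra.Polynomial"
begin

definition weight :: "real \<Rightarrow> real \<Rightarrow> real \<Rightarrow> real" where
  "weight lam z x = (1 - x\<^sup>2) powr (lam - 1/2) * exp (- z * x\<^sup>2)"

text \<open>
  For \<open>lam > -1/2\<close> the weight is Lebesgue integrable on \<open>(-1,1)\<close>, so the value \<open>0\<close>
  that the library assigns to a non-integrable function plays no role below.
\<close>

definition monic_orthogonal :: "real \<Rightarrow> real \<Rightarrow> (nat \<Rightarrow> real poly) \<Rightarrow> bool" where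
  "monic_orthogonal lam z P \<longleftrightarrow>
     (\<forall>n. degree (P n) = n \<and> lead_coeff (P n) = 1) \<and>
     (\<forall>n m. n \<noteq> m \<longrightarrow>
        (LBINT x:{-1<..<1}. poly (P n) x * poly (P m) x * weight lam z x) = 0)"

text \<open>
  \<open>c\<close> is the sequence of coefficients in \<open>x P\<^sub>n = P\<^sub>n\<^sub>+\<^sub>1 + c\<^sub>n P\<^sub>n\<^sub>-\<^sub>1\<close>, \<open>n \<ge> 0\<close>. The polynomial
  \<open>P\<^sub>-\<^sub>1 = 0\<close> is written out, since subtraction on \<open>nat\<close> truncates, and
  \<open>c\<^sub>0 = 0\<close> is the normalisation of a coefficient that the recurrence leaves free.
\<close>

definition recurrence_coeffs :: "(nat \<Rightarrow> real poly) \<Rightarrow> (nat \<Rightarrow> real) \<Rightarrow> bool" where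
  "recurrence_coeffs P c \<longleftrightarrow>
     c 0 = 0 \<and>
     (\<forall>n. [:0, 1:] * P n = P (Suc n) + smult (c n) (if n = 0 then 0 else P (n - 1)))"

definition g_fun :: "real \<Rightarrow> (nat \<Rightarrow> real \<Rightarrow> real) \<Rightarrow> nat \<Rightarrow> real \<Rightarrow> real" where
  "g_fun lam \<gamma> n z = real n / 2 + lam / 2 - 1/4 - z * \<gamma> n z"

end

theory Submission
  imports Defs
begin

text \<open>
  Write \<open>R\<^sub>n = 2n + 2\<lambda> - 2z(\<gamma>\<^sub>n + \<gamma>\<^sub>n\<^sub>+\<^sub>1)\<close> and \<open>r\<^sub>n = n - 2z\<gamma>\<^sub>n\<close>, so that \<open>2g\<^sub>n = r\<^sub>n + \<lambda> - 1/2\<close>. Integration by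
  parts against \<open>P\<^sub>n P\<^sub>n\<^sub>+\<^sub>1\<close> gives
  \<open>\<gamma>\<^sub>n\<^sub>+\<^sub>1 R\<^sub>n\<^sub>+\<^sub>1 = \<gamma>\<^sub>n R\<^sub>n\<^sub>-\<^sub>1 + r\<^sub>n\<^sub>+\<^sub>1 - r\<^sub>n\<close>; multiplied by \<open>R\<^sub>n = r\<^sub>n + r\<^sub>n\<^sub>+\<^sub>1 + 2\<lambda> - 1\<close> this telescopes to
  \<open>\<gamma>\<^sub>n R\<^sub>n R\<^sub>n\<^sub>-\<^sub>1 = r\<^sub>n (r\<^sub>n + 2\<lambda> - 1) = 4g\<^sub>n\<^sup>2 - (\<lambda> - 1/2)\<^sup>2\<close>. Differentiating the norms of the \<open>P\<^sub>n\<close> in \<open>z\<close>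
  gives the Volterra equation \<open>\<gamma>\<^sub>n' = \<gamma>\<^sub>n (\<gamma>\<^sub>n\<^sub>-\<^sub>1 - \<gamma>\<^sub>n\<^sub>+\<^sub>1)\<close>, hence \<open>2g\<^sub>n' = -\<gamma>\<^sub>n (R\<^sub>n - R\<^sub>n\<^sub>-\<^sub>1)\<close>, and
  \<open>R\<^sub>n' = (\<gamma>\<^sub>n\<^sub>+\<^sub>1 - \<gamma>\<^sub>n)(R\<^sub>n + 2z) - 1\<close>. With these, both sides of the claim become the square of
  \<open>(2g\<^sub>n - z) \<gamma>\<^sub>n (R\<^sub>n + R\<^sub>n\<^sub>-\<^sub>1)\<close>.
\<close>

subsection \<open>The moment functional\<close>

text \<open>The integrand may blow up at the endpoints as long as its antiderivative stays
  continuous there; this covers \<open>(1 - x) powr a\<close> with -1 < a < 0.\<close>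

lemma set_integrable_nonneg_deriv:
  fixes f F :: "real \<Rightarrow> real"
  assumes "u < v" and F: "continuous_on {u..v} F"
    and D: "\<And>x. u < x \<Longrightarrow> x < v \<Longrightarrow> (F has_real_derivative f x) (at x)"
    and f: "\<And>x. u < x \<Longrightarrow> x < v \<Longrightarrow> isCont f x"
    and pos: "\<And>x. u < x \<Longrightarrow> x < v \<Longrightarrow> 0 \<le> f x"
  shows "set_integrable lborel {u<..<v} f"
proof -
  have "set_integrable lborel (einterval (ereal u) (ereal v)) f"
    by (rule interval_integral_FTC_nonneg(1)[where F = F and A = "F u" and B = "F v"])
      (use assms continuous_on_Icc_at_leftD[OF F] continuous_on_Icc_at_rightD[OF F] 
        in \<open>auto simp: ereal_tendsto_simps1\<close>)
  then show ?thesis by simp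
qed

text \<open>Regularity of \<open>f\<close> is asked only inside the interval, because the weight is
  singular at both endpoints when \<open>lam < 1/2\<close>.\<close>

lemma set_integral_FTC_open:
  fixes f F :: "real \<Rightarrow> real"
  assumes "u < v" and F: "continuous_on {u..v} F"
    and D: "\<And>x. u < x \<Longrightarrow> x < v \<Longrightarrow> (F has_real_derivative f x) (at x)"
    and f: "\<And>x. u < x \<Longrightarrow> x < v \<Longrightarrow> isCont f x"
    and int: "set_integrable lborel {u<..<v} f"
  shows "(LBINT x:{u<..<v}. f x) = F v - F u"
proof -
  have "(LBINT x=ereal u..ereal v. f x) = F v - F u"
    by (rule interval_integral_FTC_integrable)
      (use assms continuous_on_Icc_at_leftD[OF F] continuous_on_Icc_at_rightD[OF F] 
        in \<open>auto simp: ereal_tendsto_simps1 has_real_derivative_iff_has_vector_derivative\<close>)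
  then show ?thesis using \<open>u < v\<close> by (simp add: interval_integral_Ioo)
qed

text \<open>Since \<open>1 - x\<^sup>2 \<ge> 1 - \<bar>x\<bar>\<close>, a negative power is
  dominated by the factor of the nearer endpoint, and a nonnegative power by 1. The sum of the three
  bounds serves all cases.\<close>

lemma set_integrable_jacobi_factor:
  fixes a :: real
  assumes "a > -1"
  shows "set_integrable lborel {-1<..<1} (\<lambda>x. (1 - x\<^sup>2) powr a)"
proof -
  have "set_integrable lborel {-1<..<1} (\<lambda>x::real. (1 - x) powr a)"
    by (rule set_integrable_nonneg_deriv[where F = "\<lambda>x. - ((1 - x) powr (a + 1)) / (a + 1)"])
      (use assms in \<open>auto intro!: derivative_eq_intros continuous_intros continuous_on_powr'\<close>)
  moreover have "set_integrable lborel {-1<..<1} (\<lambda>x::real. (1 + x) powr a)"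
    by (rule set_integrable_nonneg_deriv[where F = "\<lambda>x. ((1 + x) powr (a + 1)) / (a + 1)"])
      (use assms in \<open>auto intro!: derivative_eq_intros continuous_intros continuous_on_powr'\<close>)
  moreover have "set_integrable lborel {-1<..<1} (\<lambda>x::real. 1::real)"
    by (auto simp: set_integrable_def)
  ultimately have "set_integrable lborel {-1<..<1} (\<lambda>x::real. 1 + ((1 - x) powr a + (1 + x) powr a))"
    by (intro set_integral_add)
  then show ?thesis
  proof (rule set_integrable_bound)
    show "set_borel_measurable lborel {-1<..<1} (\<lambda>x::real. (1 - x\<^sup>2) powr a)"
      unfolding set_borel_measurable_def by measurable
    have "(1 - x\<^sup>2) powr a \<le> 1 + ((1 - x) powr a + (1 + x) powr a)"
      if x: "-1 < x" "x < 1" for x :: real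
    proof (cases "a \<ge> 0")
      case True
      have "(1 - x\<^sup>2) powr a \<le> 1 powr a"
        using x True by (intro powr_mono2) (auto simp: abs_square_le_1)
      then show ?thesis by (auto intro: add_increasing2)
    next
      case False
      show ?thesis
      proof (cases "x \<ge> 0")
        case True
        then have "1 - x \<le> 1 - x\<^sup>2"
          using x mult_left_le[of x x] by (simp add: power2_eq_square)
        then have "(1 - x\<^sup>2) powr a \<le> (1 - x) powr a"
          using False x by (intro powr_mono2') auto
        then show ?thesis by (simp add: add_increasing add_increasing2)
      next
        case neg: False
        then have "1 + x \<le> 1 - x\<^sup>2"
          using x mult_left_le[of "-x" "-x"] by (simp add: power2_eq_square)
        then have "(1 - x\<^sup>2) powr a \<le> (1 + x) powr a"
          using False x by (intro powr_mono2') auto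
        then show ?thesis by (simp add: add_increasing add_increasing2)
      qed
    qed
    then show "AE x in lborel. x \<in> {-1<..<1} \<longrightarrow>
        norm ((1 - x\<^sup>2) powr a) \<le> norm (1 + ((1 - x) powr a + (1 + x) powr a))"
      by (auto simp: abs_of_nonneg add_nonneg_nonneg)
  qed
qed

text \<open>Controls the remainder when the exponential factor is differentiated under the
  integral.\<close>

lemma exp_taylor2_bound:
  fixes u :: real
  assumes "\<bar>u\<bar> \<le> 1"
  shows "\<bar>exp u - 1 - u\<bar> \<le> u\<^sup>2"
proof (cases "u \<ge> 0")
  case True
  then show ?thesis
    using exp_bound[of u] exp_ge_add_one_self[of u] assms zero_le_power2[of u]
    unfolding abs_le_iff by linarith
next
  case False
  define v where "v = - u"
  have v: "0 < v" using False by (simp add: v_def)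
  \<comment> \<open>The last bound in this chain is (1 + v)(1 - v + v^2) = 1 + v^3 \<ge> 1.\<close>
  have "exp u = 1 / exp v" by (simp add: v_def exp_minus divide_simps)
  also have "\<dots> \<le> 1 / (1 + v)"
    using exp_ge_add_one_self[of v] v by (intro divide_left_mono) auto
  also have "\<dots> \<le> 1 - v + v\<^sup>2"
    using v by (simp add: divide_simps power2_eq_square algebra_simps)
  finally show ?thesis
    using exp_ge_add_one_self[of u] zero_le_power2[of u]
    unfolding v_def abs_le_iff power2_minus by linarith
qed

text \<open>Identities in the parameter are available only for \<open>t > 0\<close>; differentiation
  is local, so the open half-line suffices.\<close>

lemma DERIV_transform_pos:
  fixes f g :: "real \<Rightarrow> real"
  assumes "(f has_real_derivative d) (at t0)" and "t0 > 0" and "\<And>t. t > 0 \<Longrightarrow> f t = g t"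
  shows "(g has_real_derivative d) (at t0)"
  by (rule has_field_derivative_transform_within_open[OF assms(1), where S = "{0<..}"])
    (use assms in auto)

section \<open>The functional: positivity, Pearson identity, parameter derivative\<close>

definition moment_functional :: "real \<Rightarrow> real \<Rightarrow> real poly \<Rightarrow> real" where
  "moment_functional lam z p = (LBINT x:{-1<..<1}. poly p x * weight lam z x)"

text \<open>Polynomial times exponential is bounded on the compact interval, which leaves the
  algebraic factor with exponent \<open>lam - 1/2 > -1\<close>.\<close>

lemma set_integrable_poly_weight:
  assumes "lam > -1/2"
  shows "set_integrable lborel {-1<..<1} (\<lambda>x. poly p x * weight lam z x)"
proof -
  have "continuous_on {-1..1} (\<lambda>x. poly p x * exp (- z * x\<^sup>2))"
    by (intro continuous_intros)
  then have "bounded ((\<lambda>x. poly p x * exp (- z * x\<^sup>2)) ` {-1..1})"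
    by (intro compact_imp_bounded compact_continuous_image) auto
  then obtain C where C: "\<And>x. x \<in> {-1..1} \<Longrightarrow> \<bar>poly p x * exp (- z * x\<^sup>2)\<bar> \<le> C"
    unfolding bounded_iff ball_simps real_norm_def by blast
  have "set_integrable lborel {-1<..<1} (\<lambda>x. C * (1 - x\<^sup>2) powr (lam - 1/2))"
    using assms by (intro set_integrable_mult_right set_integrable_jacobi_factor) auto
  then show ?thesis
  proof (rule set_integrable_bound)
    have [measurable]: "poly p \<in> borel_measurable borel"
      by (intro borel_measurable_continuous_onI continuous_intros)
    show "set_borel_measurable lborel {-1<..<1} (\<lambda>x. poly p x * weight lam z x)"
      unfolding set_borel_measurable_def weight_def by measurable
    have "\<bar>poly p x * weight lam z x\<bar> \<le> \<bar>C * (1 - x\<^sup>2) powr (lam - 1/2)\<bar>"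
      if "x \<in> {-1<..<1}" for x
    proof -
      have "\<bar>poly p x * weight lam z x\<bar> = \<bar>poly p x * exp (- z * x\<^sup>2)\<bar> * (1 - x\<^sup>2) powr (lam - 1/2)"
        by (simp add: weight_def abs_mult)
      also have "\<dots> \<le> C * (1 - x\<^sup>2) powr (lam - 1/2)"
        using C[of x] that by (intro mult_right_mono) auto
      finally show ?thesis by linarith
    qed
    then show "AE x in lborel. x \<in> {-1<..<1} \<longrightarrow>
        norm (poly p x * weight lam z x) \<le> norm (C * (1 - x\<^sup>2) powr (lam - 1/2))"
      by simp
  qed
qed

lemma moment_functional_add:
  assumes "lam > -1/2"
  shows "moment_functional lam z (p + q) = moment_functional lam z p + moment_functional lam z q"
  unfolding moment_functional_def
  by (subst set_integral_add(2)[symmetric])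
    (use set_integrable_poly_weight[OF assms] in \<open>auto simp: algebra_simps\<close>)

lemma moment_functional_smult:
  "moment_functional lam z (smult c p) = c * moment_functional lam z p"
  unfolding moment_functional_def by (simp flip: set_integral_mult_right add: mult.assoc)

text \<open>The weight is positive inside the interval, so a zero integral would force
  \<open>p\<close> to vanish almost everywhere there, against the finiteness of its root
  set.\<close>

lemma moment_functional_pos:
  assumes "lam > -1/2" and "p \<noteq> 0"
  shows "moment_functional lam z (p * p) > 0"
proof -
  let ?f = "\<lambda>x. indicator {-1<..<1} x *\<^sub>R (poly (p * p) x * weight lam z x)"
  have int: "integrable lborel ?f"
    using set_integrable_poly_weight[OF assms(1)] unfolding set_integrable_def by blast
  have nonneg: "?f x \<ge> 0" for x
    by (auto simp: indicator_def weight_def)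
  have "moment_functional lam z (p * p) \<noteq> 0"
  proof
    assume "moment_functional lam z (p * p) = 0"
    then have "AE x in lborel. ?f x = 0"
      using integral_nonneg_eq_0_iff_AE[OF int] nonneg
      unfolding moment_functional_def set_lebesgue_integral_def by auto
    moreover have "?f x = 0 \<Longrightarrow> x \<notin> {-1<..<1} \<or> x \<in> {x. poly p x = 0}" for x
      by (auto simp: indicator_def weight_def power2_eq_1_iff split: if_splits)
    ultimately have "AE x in lborel. x \<notin> {-1<..<1} \<or> x \<in> {x. poly p x = 0}"
      by (rule eventually_mono)
    moreover have "AE x in lborel. x \<notin> {x. poly p x = 0}"
      using poly_roots_finite[OF assms(2)]
      by (intro AE_not_in finite_imp_null_set_lborel)
    ultimately have "AE x in lborel. x \<notin> {-1<..<1::real}"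
      by eventually_elim blast
    then have "emeasure lborel {-1<..<1::real} = 0"
      by (subst (asm) AE_iff_measurable[where N = "{-1<..<1}"]) auto
    then show False by simp
  qed
  moreover have "moment_functional lam z (p * p) \<ge> 0"
    unfolding moment_functional_def set_lebesgue_integral_def
    by (intro Bochner_Integration.integral_nonneg nonneg)
  ultimately show ?thesis by simp
qed

text \<open>The integrand is the derivative of \<open>q\<close> times (1 - x^2) times the weight.
  The boundary terms vanish because the exponent \<open>lam + 1/2\<close> is positive.\<close>

lemma moment_functional_pearson:
  assumes "lam > -1/2"
  shows "moment_functional lam z
    ([:1, 0, -1:] * pderiv q + q * [:0, - 2 * (lam + 1/2 + z), 0, 2 * z:]) = 0"
proof -
  let ?p = "[:1, 0, -1:] * pderiv q + q * [:0, - 2 * (lam + 1/2 + z), 0, 2 * z:]"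
  let ?F = "\<lambda>x. poly q x * ((1 - x\<^sup>2) powr (lam + 1/2) * exp (- z * x\<^sup>2))"
  have "(LBINT x:{-1<..<1}. poly ?p x * weight lam z x) = ?F 1 - ?F (-1)"
  proof (rule set_integral_FTC_open)
    show "continuous_on {-1..1} ?F"
      using assms by (intro continuous_intros continuous_on_powr') (auto simp: abs_square_le_1)
    fix x :: real assume x: "-1 < x" "x < 1"
    then have pos: "1 - x\<^sup>2 > 0" by (simp add: abs_square_less_1)
    have eq: "(1 - x\<^sup>2) powr (lam + 1/2) = (1 - x\<^sup>2) * (1 - x\<^sup>2) powr (lam - 1/2)"
      using pos powr_add[of "1 - x\<^sup>2" 1 "lam - 1/2"] by (simp add: add.commute)
    have "(?F has_real_derivative 
       poly (pderiv q) x * ((1 - x\<^sup>2) powr (lam + 1/2) * exp (- z * x\<^sup>2)) +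
       poly q x * ((lam + 1/2) * (1 - x\<^sup>2) powr (lam - 1/2) * (- 2 * x) * exp (- z * x\<^sup>2)
         + (1 - x\<^sup>2) powr (lam + 1/2) * exp (- z * x\<^sup>2) * (- z * (2 * x)))) (at x)"
      using pos by (auto intro!: derivative_eq_intros simp: algebra_simps)
    also have "poly (pderiv q) x * ((1 - x\<^sup>2) powr (lam + 1/2) * exp (- z * x\<^sup>2)) +
       poly q x * ((lam + 1/2) * (1 - x\<^sup>2) powr (lam - 1/2) * (- 2 * x) * exp (- z * x\<^sup>2)
         + (1 - x\<^sup>2) powr (lam + 1/2) * exp (- z * x\<^sup>2) * (- z * (2 * x)))
       = poly ?p x * weight lam z x"
      unfolding eq weight_def by (simp add: algebra_simps power2_eq_square)
    finally show "(?F has_real_derivative poly ?p x * weight lam z x) (at x)" .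
    show "isCont (\<lambda>x. poly ?p x * weight lam z x) x"
      using pos unfolding weight_def by (auto intro!: continuous_intros)
  qed (simp, rule set_integrable_poly_weight[OF assms])
  then show ?thesis using assms by (simp add: moment_functional_def)
qed

text \<open>Shifting \<open>z\<close> by \<open>h\<close> multiplies the weight by exp(-h x^2). On
  the interval its remainder after the linear term is at most h^2, so the difference quotient errs
  by at most \<open>\<bar>h\<bar> * K\<close>.\<close>

lemma moment_functional_deriv:
  assumes "lam > -1/2"
  shows "((\<lambda>t. moment_functional lam t p) has_real_derivative
    - moment_functional lam z ([:0, 0, 1:] * p)) (at z)"
proof -
  let ?L = "moment_functional lam"
  define K where "K = (LBINT x:{-1<..<1}. \<bar>poly p x * weight lam z x\<bar>)"
  have bound: "\<bar>?L (z + h) p - ?L z p + h * ?L z ([:0, 0, 1:] * p)\<bar> \<le> h\<^sup>2 * K" if h: "\<bar>h\<bar> \<le> 1" for h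
  proof -
    let ?d = "\<lambda>x. poly p x * weight lam (z + h) x - poly p x * weight lam z x
        + h * (poly ([:0, 0, 1:] * p) x * weight lam z x)"
    note w = set_integrable_poly_weight[OF assms]
    have int: "set_integrable lborel {-1<..<1} ?d"
      by (intro set_integral_add(1) set_integral_diff(1) set_integrable_mult_right
          set_integrable_poly_weight assms)
    have eq: "?L (z + h) p - ?L z p + h * ?L z ([:0, 0, 1:] * p) = (LBINT x:{-1<..<1}. ?d x)"
      unfolding moment_functional_def set_integral_mult_right[symmetric]
      by (simp only: set_integral_add(2)[OF set_integral_diff(1)[OF w w] set_integrable_mult_right[OF w]]
        set_integral_diff(2)[OF w w])
    have "\<bar>?L (z + h) p - ?L z p + h * ?L z ([:0, 0, 1:] * p)\<bar> \<le> (LBINT x:{-1<..<1}. \<bar>?d x\<bar>)"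
      unfolding eq using set_integral_norm_bound[OF int] unfolding real_norm_def .
    also have "\<dots> \<le> (LBINT x:{-1<..<1}. h\<^sup>2 * \<bar>poly p x * weight lam z x\<bar>)"
    proof (rule set_integral_mono)
      fix x :: real assume x: "x \<in> {-1<..<1}"
      then have x2: "x\<^sup>2 \<le> 1" by (auto simp: abs_square_le_1)
      have hx: "\<bar>h * x\<^sup>2\<bar> \<le> \<bar>h\<bar>"
        using x2 by (simp add: abs_mult mult_left_le)
      have shift: "weight lam (z + h) x = weight lam z x * exp (- (h * x\<^sup>2))"
        unfolding weight_def mult.assoc exp_add[symmetric] by (simp add: algebra_simps)
      have "?d x = poly p x * weight lam z x * (exp (- (h * x\<^sup>2)) - 1 - (- (h * x\<^sup>2)))"
        unfolding shift by (simp add: algebra_simps power2_eq_square)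
      moreover have "\<bar>exp (- (h * x\<^sup>2)) - 1 - (- (h * x\<^sup>2))\<bar> \<le> (- (h * x\<^sup>2))\<^sup>2"
        using hx h by (intro exp_taylor2_bound) auto
      moreover have "(- (h * x\<^sup>2))\<^sup>2 \<le> h\<^sup>2"
        using hx by (metis abs_le_square_iff power2_minus)
      ultimately show "\<bar>?d x\<bar> \<le> h\<^sup>2 * \<bar>poly p x * weight lam z x\<bar>"
        unfolding mult.commute[of "h\<^sup>2"] by (simp only: abs_mult) (rule mult_left_mono, linarith, simp)
    qed (intro set_integrable_abs set_integrable_mult_right int w)+
    finally show ?thesis by (simp add: K_def)
  qed
  have "((\<lambda>h. (?L (z + h) p - ?L z p) / h - (- ?L z ([:0, 0, 1:] * p))) \<longlongrightarrow> 0) (at 0)"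
  proof (rule Lim_null_comparison)
    show "\<forall>\<^sub>F h in at 0. norm ((?L (z + h) p - ?L z p) / h - (- ?L z ([:0, 0, 1:] * p))) \<le> \<bar>h\<bar> * K"
      unfolding eventually_at
    proof (intro exI[of _ 1] conjI ballI impI)
      fix h :: real assume "h \<noteq> 0 \<and> dist h 0 < 1"
      then have h: "h \<noteq> 0" "\<bar>h\<bar> \<le> 1" by auto
      have eq: "(?L (z + h) p - ?L z p) / h - (- ?L z ([:0, 0, 1:] * p))
          = (?L (z + h) p - ?L z p + h * ?L z ([:0, 0, 1:] * p)) / h"
        using h by (simp add: field_simps)
      have "\<bar>(?L (z + h) p - ?L z p) / h - (- ?L z ([:0, 0, 1:] * p))\<bar> \<le> h\<^sup>2 * K / \<bar>h\<bar>"
        unfolding eq using bound[OF h(2)] h(1) by (simp add: abs_divide divide_right_mono)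
      also have "\<dots> = \<bar>h\<bar> * K"
        using h(1) by (simp add: power2_eq_square field_simps flip: abs_mult)
      finally show "norm ((?L (z + h) p - ?L z p) / h - (- ?L z ([:0, 0, 1:] * p))) \<le> \<bar>h\<bar> * K"
        by simp
    qed simp
    show "((\<lambda>h. \<bar>h\<bar> * K) \<longlongrightarrow> 0) (at 0)"
      by (auto intro!: tendsto_eq_intros)
  qed
  then show ?thesis
    unfolding DERIV_def by (rule LIM_zero_cancel)
qed

lemma moment_functional_0: "moment_functional lam z 0 = 0"
  using moment_functional_smult[of lam z 0 0] by simp

lemma moment_functional_minus:
  "moment_functional lam z (- p) = - moment_functional lam z p"
  using moment_functional_smult[of lam z "-1" p] by simp

lemma moment_functional_diff:
  assumes "lam > -1/2"
  shows "moment_functional lam z (p - q) = moment_functional lam z p - moment_functional lam z q"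
  using moment_functional_add[OF assms, of z p "- q"] by (simp add: moment_functional_minus)

subsection \<open>Recurrence coefficients\<close>

text \<open>No regularity in \<open>t\<close> is assumed: the families are given separately for each
  positive parameter, and differentiability is derived.\<close>

locale gegenbauer_recurrence =
  fixes lam :: real and P :: "real \<Rightarrow> nat \<Rightarrow> real poly" and \<gamma> :: "nat \<Rightarrow> real \<Rightarrow> real"
  assumes lam: "lam > -1/2"
    and orth: "t > 0 \<Longrightarrow> monic_orthogonal lam t (P t)"
    and rec: "t > 0 \<Longrightarrow> recurrence_coeffs (P t) (\<lambda>k. \<gamma> k t)"
begin

abbreviation L :: "real \<Rightarrow> real poly \<Rightarrow> real" where
  "L \<equiv> moment_functional lam"

lemmas L_linear = moment_functional_0 moment_functional_smult moment_functional_add[OF lam]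
  moment_functional_diff[OF lam] moment_functional_minus

definition h :: "nat \<Rightarrow> real \<Rightarrow> real" where
  "h n t = L t (P t n * P t n)"

definition R :: "nat \<Rightarrow> real \<Rightarrow> real" where
  "R n t = 2 * real n + 2 * lam - 2 * t * (\<gamma> n t + \<gamma> (Suc n) t)"

text \<open>The coefficient of \<open>x\<^sup>n\<^sup>-\<^sup>1\<close> in \<open>P\<^sub>n\<^sub>+\<^sub>1\<close>; the shift by \<open>pCons\<close> makes it \<open>0\<close> for \<open>n = 0\<close>.\<close>

definition s :: "nat \<Rightarrow> real \<Rightarrow> real" where
  "s n t = coeff (pCons 0 (P t (Suc n))) n"

context
  fixes t :: real
  assumes t: "t > 0"
begin

section \<open>Orthogonality and moments at a fixed parameter\<close>

lemma degree_P [simp]: "degree (P t n) = n"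
  and coeff_P_same [simp]: "coeff (P t n) n = 1"
  using orth[OF t] unfolding monic_orthogonal_def by metis+

lemma coeff_P_gt: "i > n \<Longrightarrow> coeff (P t n) i = 0"
  by (simp add: coeff_eq_0)

lemma L_P_P: "n \<noteq> m \<Longrightarrow> L t (P t n * P t m) = 0"
  using orth[OF t] unfolding monic_orthogonal_def moment_functional_def by simp

lemma \<gamma>_0 [simp]: "\<gamma> 0 t = 0"
  and x_P_0: "pCons 0 (P t 0) = P t 1"
  and x_P_Suc: "pCons 0 (P t (Suc n)) = P t (Suc (Suc n)) + smult (\<gamma> (Suc n) t) (P t n)"
proof -
  have *: "\<And>n. [:0, 1:] * P t n = P t (Suc n) + smult (\<gamma> n t) (if n = 0 then 0 else P t (n - 1))"
    and "\<gamma> 0 t = 0"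
    using rec[OF t] unfolding recurrence_coeffs_def by auto
  then show "\<gamma> 0 t = 0" by simp
  show "pCons 0 (P t 0) = P t 1" using *[of 0] by simp
  show "pCons 0 (P t (Suc n)) = P t (Suc (Suc n)) + smult (\<gamma> (Suc n) t) (P t n)"
    using *[of "Suc n"] by simp
qed

text \<open>Subtracting a multiple of \<open>P t m\<close> removes the top coefficient. Bounding the
  degree through coefficients lets \<open>m = 0\<close> mean \<open>q = 0\<close>.\<close>

lemma L_P_low: "(\<And>i. i \<ge> m \<Longrightarrow> coeff q i = 0) \<Longrightarrow> m \<le> n \<Longrightarrow> L t (P t n * q) = 0"
proof (induction m arbitrary: q)
  case 0
  then have "q = 0" by (simp add: poly_eq_iff)
  then show ?case by (simp add: L_linear)
next
  case (Suc m)
  define q' where "q' = q - smult (coeff q m) (P t m)"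
  have "coeff q' i = 0" if "i \<ge> m" for i
    using that Suc.prems(1)[of i] by (cases "i = m") (auto simp: q'_def coeff_P_gt)
  then have "L t (P t n * q') = 0"
    using Suc by auto
  moreover have "q = q' + smult (coeff q m) (P t m)"
    by (simp add: q'_def)
  ultimately show ?case
    using L_P_P[of n m] Suc.prems(2)
    by (metis L_linear(2,3) Suc_n_not_le_n add_0 distrib_left mult_smult_right mult_zero_right)
qed

text \<open>The main evaluation device: modulo lower degree, \<open>q\<close> is its
  \<open>n\<close>-th coefficient times \<open>P t n\<close>.\<close>

lemma L_P_coeff: 
  assumes "\<And>i. i > n \<Longrightarrow> coeff q i = 0"
  shows "L t (P t n * q) = coeff q n * h n t"
proof -
  define q' where "q' = q - smult (coeff q n) (P t n)"
  have "coeff q' i = 0" if "i \<ge> n" for i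
    using that assms[of i] by (cases "i = n") (auto simp: q'_def coeff_P_gt)
  then have "L t (P t n * q') = 0"
    using L_P_low[of n q' n] by auto
  moreover have "q = q' + smult (coeff q n) (P t n)"
    by (simp add: q'_def)
  ultimately show ?thesis
    by (metis L_linear(2,3) add_0 distrib_left h_def mult_smult_right)
qed

lemma h_pos: "h n t > 0"
  unfolding h_def using coeff_P_same[of n]
  by (intro moment_functional_pos lam) (metis coeff_0 zero_neq_one)

lemma L_P_xP: "L t (P t (Suc n) * pCons 0 (P t n)) = h (Suc n) t"
  by (subst L_P_coeff) (auto simp: coeff_pCons coeff_P_gt split: nat.split)

text \<open>Evaluate L(x P_n P_{n+1}) twice, once with \<open>x\<close> on each factor. This
  exhibits the recurrence coefficient as a ratio of norms.\<close>

lemma h_Suc: "h (Suc n) t = \<gamma> (Suc n) t * h n t"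
proof -
  have "h (Suc n) t = L t (P t n * pCons 0 (P t (Suc n)))"
    unfolding L_P_xP[symmetric] by (simp add: mult.commute)
  also have "\<dots> = \<gamma> (Suc n) t * h n t"
    unfolding x_P_Suc by (simp add: distrib_left L_linear L_P_P h_def)
  finally show ?thesis .
qed

text \<open>Give one \<open>x\<close> to each factor and square the recurrence; orthogonality kills
  the cross term.\<close>

lemma L_P_x2P: "L t (P t n * pCons 0 (pCons 0 (P t n))) = (\<gamma> n t + \<gamma> (Suc n) t) * h n t"
proof -
  have "L t (P t n * pCons 0 (pCons 0 (P t n))) = L t (pCons 0 (P t n) * pCons 0 (P t n))"
    by simp
  also have "\<dots> = (\<gamma> n t + \<gamma> (Suc n) t) * h n t"
  proof (cases n)
    case 0
    then show ?thesis using h_Suc[of 0] by (simp add: x_P_0 h_def[symmetric])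
  next
    case (Suc m)
    have "pCons 0 (P t n) * pCons 0 (P t n) = P t (Suc n) * P t (Suc n)
        + smult (2 * \<gamma> n t) (P t (Suc n) * P t m) + smult ((\<gamma> n t)\<^sup>2) (P t m * P t m)"
      unfolding Suc x_P_Suc
      by (rule poly_eq_poly_eq_iff[THEN iffD1]) (simp add: fun_eq_iff algebra_simps power2_eq_square)
    then have "L t (pCons 0 (P t n) * pCons 0 (P t n)) = h (Suc n) t + (\<gamma> n t)\<^sup>2 * h m t"
      by (simp add: L_linear L_P_P h_def Suc)
    then show ?thesis
      using h_Suc[of n] h_Suc[of m] by (simp add: Suc algebra_simps power2_eq_square)
  qed
  finally show ?thesis .
qed

text \<open>Expand one x P_n by the recurrence: the P_{n+1} part is the previous lemma, and x^2
  P_{n-1} is monic of degree n+1.\<close>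

lemma L_P_x3P: "L t (P t (Suc n) * pCons 0 (pCons 0 (pCons 0 (P t n))))
    = (\<gamma> n t + \<gamma> (Suc n) t + \<gamma> (Suc (Suc n)) t) * h (Suc n) t"
proof (cases n)
  case 0
  show ?thesis using L_P_x2P[of 1] by (simp add: 0 x_P_0)
next
  case (Suc m)
  have "L t (P t (Suc n) * pCons 0 (pCons 0 (P t m))) = h (Suc n) t"
    by (subst L_P_coeff) (auto simp: Suc coeff_pCons coeff_P_gt split: nat.split)
  moreover have "pCons 0 (pCons 0 (pCons 0 (P t n)))
      = pCons 0 (pCons 0 (P t (Suc n))) + smult (\<gamma> n t) (pCons 0 (pCons 0 (P t m)))"
    using x_P_Suc[of m] by (simp add: Suc)
  ultimately show ?thesis
    using L_P_x2P[of "Suc n"] by (simp only: distrib_left mult_smult_right L_linear) (simp add: algebra_simps)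
qed

text \<open>The only trace of the parity of P_n that is used; it comes from the missing diagonal
  term in the recurrence.\<close>

lemma coeff_P_pred: "coeff (P t (Suc n)) n = 0"
proof (induction n)
  case 0
  show ?case using arg_cong[OF x_P_0, of "\<lambda>p. coeff p 0"] by simp
next
  case (Suc n)
  show ?case using arg_cong[OF x_P_Suc[of n], of "\<lambda>p. coeff p (Suc n)"] Suc
    by (simp add: coeff_P_gt)
qed

lemma s_0: "s 0 t = 0"
  by (simp add: s_def)

lemma s_Suc: "s (Suc n) t = s n t - \<gamma> (Suc n) t"
  using arg_cong[OF x_P_Suc[of n], of "\<lambda>p. coeff p n"] by (simp add: s_def)

text \<open>The Euler operator x d/dx multiplies the coefficient of x^i by i. Subtracting n+1 times
  P_{n+1} thus cancels the leading term, and parity removes the next, so \<open>e\<close> has degree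
  below \<open>n\<close>.\<close>

lemma L_P_x2_deriv: "L t (P t n * pCons 0 (pCons 0 (pderiv (P t (Suc n)))))
    = real (Suc n) * h (Suc n) t - 2 * s n t * h n t"
proof -
  define e where "e = pCons 0 (pderiv (P t (Suc n))) - smult (real (Suc n)) (P t (Suc n))"
  have e: "coeff e i = (real i - real (Suc n)) * coeff (P t (Suc n)) i" for i
    by (cases i) (auto simp: e_def coeff_pderiv algebra_simps)
  have "coeff (pCons 0 e) i = 0" if "i > n" for i
  proof -
    obtain j where j: "i = Suc j" "j \<ge> n" using \<open>i > n\<close> by (cases i) auto
    show ?thesis
      using j coeff_P_pred[of n] by (cases "j = n \<or> j = Suc n") (auto simp: e coeff_P_gt)
  qed
  then have "L t (P t n * pCons 0 e) = coeff (pCons 0 e) n * h n t"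
    by (rule L_P_coeff)
  \<comment> \<open>The factor -2 is (n-1) - (n+1); for \<open>n = 0\<close> both sides
    vanish.\<close>
  moreover have "coeff (pCons 0 e) n = - 2 * s n t"
    by (cases n) (auto simp: s_def e)
  moreover have "pCons 0 (pCons 0 (pderiv (P t (Suc n))))
      = smult (real (Suc n)) (pCons 0 (P t (Suc n))) + pCons 0 e"
    by (simp add: e_def)
  moreover have "L t (P t n * pCons 0 (P t (Suc n))) = h (Suc n) t"
    using L_P_xP[of n] by (simp add: mult.commute)
  ultimately show ?thesis
    by (simp only: distrib_left mult_smult_right L_linear)
qed

text \<open>Apply the Pearson identity to P_{n+1} P_n. By \<open>h_Suc\<close> every term carries
  the factor \<open>h n t\<close>, which is positive and cancels.\<close>

lemma laguerre_freud:
  "\<gamma> (Suc n) t * (2 * real n + 2 + 2 * lam + 2 * t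
      - 2 * t * (\<gamma> n t + \<gamma> (Suc n) t + \<gamma> (Suc (Suc n)) t)) = real (Suc n) + 2 * s n t"
proof -
  let ?A = "P t (Suc n)" and ?B = "P t n"
  have 1: "L t (?B * pderiv ?A) = real (Suc n) * h n t"
    by (subst L_P_coeff) (auto simp: coeff_pderiv coeff_P_gt)
  have 2: "L t (?A * pderiv ?B) = 0"
    by (subst L_P_coeff) (auto simp: coeff_pderiv coeff_P_gt)
  have 3: "L t (?A * pCons 0 (pCons 0 (pderiv ?B))) = real n * h (Suc n) t"
    by (subst L_P_coeff) (auto simp: coeff_pCons coeff_pderiv coeff_P_gt split: nat.split)
  have "[:1, 0, -1:] * pderiv (?A * ?B) + ?A * ?B * [:0, - 2 * (lam + 1/2 + t), 0, 2 * t:]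
      = ?B * pderiv ?A - ?B * pCons 0 (pCons 0 (pderiv ?A))
        + (?A * pderiv ?B - ?A * pCons 0 (pCons 0 (pderiv ?B)))
        + (smult (- 2 * (lam + 1/2 + t)) (?A * pCons 0 ?B)
        + smult (2 * t) (?A * pCons 0 (pCons 0 (pCons 0 ?B))))"
    by (rule poly_eq_poly_eq_iff[THEN iffD1]) (simp add: fun_eq_iff pderiv_mult algebra_simps)
  then have "L t (?B * pderiv ?A - ?B * pCons 0 (pCons 0 (pderiv ?A))
        + (?A * pderiv ?B - ?A * pCons 0 (pCons 0 (pderiv ?B)))
        + (smult (- 2 * (lam + 1/2 + t)) (?A * pCons 0 ?B)
        + smult (2 * t) (?A * pCons 0 (pCons 0 (pCons 0 ?B))))) = 0"
    using moment_functional_pearson[OF lam, of t "?A * ?B"] by (simp only:)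
  then have "h n t * (\<gamma> (Suc n) t * (2 * real n + 2 + 2 * lam + 2 * t
      - 2 * t * (\<gamma> n t + \<gamma> (Suc n) t + \<gamma> (Suc (Suc n)) t))) = h n t * (real (Suc n) + 2 * s n t)"
    unfolding L_linear 1 2 3 L_P_x2_deriv L_P_xP L_P_x3P h_Suc
    by (simp add: algebra_simps)
  then show ?thesis using h_pos[of n] by simp
qed

section \<open>Recurrence and product formula for \<open>R\<close>\<close>

lemma R_rec_0: "\<gamma> 1 t * R 1 t = 1 - 2 * t * \<gamma> 1 t"
  using laguerre_freud[of 0] by (simp add: s_0 R_def algebra_simps)

text \<open>Differencing consecutive Laguerre-Freud equations eliminates the accumulated sum
  \<open>s\<close>.\<close>

lemma R_rec: "\<gamma> (Suc (Suc n)) t * R (Suc (Suc n)) t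
    = \<gamma> (Suc n) t * R n t + 2 * t * (\<gamma> (Suc n) t - \<gamma> (Suc (Suc n)) t) + 1"
  using laguerre_freud[of n] laguerre_freud[of "Suc n"] by (simp add: s_Suc R_def algebra_simps)

text \<open>After multiplication by \<open>R n t\<close> the recurrence for \<open>R\<close> telescopes.\<close>

lemma R_R: "\<gamma> (Suc n) t * R (Suc n) t * R n t
    = (real (Suc n) - 2 * t * \<gamma> (Suc n) t) * (real (Suc n) - 2 * t * \<gamma> (Suc n) t + 2 * lam - 1)"
proof (induction n)
  case 0
  have "\<gamma> (Suc 0) t * R (Suc 0) t * R 0 t = (1 - 2 * t * \<gamma> 1 t) * R 0 t"
    using R_rec_0 by simp
  then show ?case by (simp add: R_def algebra_simps)
next
  case (Suc n)
  let ?r = "\<lambda>n. real n - 2 * t * \<gamma> n t"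
  have "\<gamma> (Suc (Suc n)) t * R (Suc (Suc n)) t * R (Suc n) t
     = \<gamma> (Suc n) t * R (Suc n) t * R n t + (?r (Suc (Suc n)) - ?r (Suc n)) * R (Suc n) t"
    unfolding R_rec by (simp add: algebra_simps)
  \<comment> \<open>Hence the added term is the increment of r (r + 2 lam - 1).\<close>
  moreover have "R (Suc n) t = ?r (Suc n) + ?r (Suc (Suc n)) + 2 * lam - 1"
    by (simp add: R_def algebra_simps)
  ultimately show ?case using Suc.IH by algebra
qed

end

subsection \<open>Dependence on the parameter\<close>

lemma L_sum: "L t (\<Sum>i\<in>A. f i) = (\<Sum>i\<in>A. L t (f i))"
  by (induction A rule: infinite_finite_induct) (simp_all add: L_linear)

text \<open>A fixed degree bound turns \<open>L t (Q t * B)\<close> into a finite sum of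
  coefficients times moments; the product rule separates the variation of \<open>Q\<close> from that
  of the weight.\<close>

lemma L_has_real_derivative:
  assumes "t0 > 0"
    and d: "\<And>k. k \<le> N \<Longrightarrow> ((\<lambda>t. coeff (Q t) k) has_real_derivative d k) (at t0)"
    and deg: "\<And>t. t > 0 \<Longrightarrow> degree (Q t) \<le> N"
  shows "((\<lambda>t. L t (Q t * B)) has_real_derivative
    (\<Sum>k\<le>N. d k * L t0 (monom 1 k * B)) - L t0 (pCons 0 (pCons 0 (Q t0 * B)))) (at t0)"
proof -
  \<comment> \<open>Stated for any linear \<open>f\<close>, as it is used both for the functional
    and for its derivative, with the extra x^2.\<close>
  have expand: "f (Q t) = (\<Sum>k\<le>N. coeff (Q t) k * f (monom 1 k))"
    if "t > 0" and f: "\<And>(A :: nat set) g. f (\<Sum>i\<in>A. g i) = (\<Sum>i\<in>A. f (g i))" "\<And>c p. f (smult c p) = c * f p"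
    for t and f :: "real poly \<Rightarrow> real"
  proof -
    have "Q t = (\<Sum>k\<le>N. smult (coeff (Q t) k) (monom 1 k))"
      using poly_as_sum_of_monoms'[OF deg[OF \<open>t > 0\<close>]] by (simp add: smult_monom)
    then have "f (Q t) = f (\<Sum>k\<le>N. smult (coeff (Q t) k) (monom 1 k))"
      by simp
    also have "\<dots> = (\<Sum>k\<le>N. coeff (Q t) k * f (monom 1 k))"
      by (simp only: f)
    finally show ?thesis .
  qed
  have "((\<lambda>t. \<Sum>k\<le>N. coeff (Q t) k * L t (monom 1 k * B)) has_real_derivative
      (\<Sum>k\<le>N. d k * L t0 (monom 1 k * B)
        + coeff (Q t0) k * - L t0 (pCons 0 (pCons 0 (monom 1 k * B))))) (at t0)"
    using d moment_functional_deriv[OF lam]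
    by (intro DERIV_sum) (auto intro!: derivative_eq_intros)
  moreover have "(\<Sum>k\<le>N. d k * L t0 (monom 1 k * B)
        + coeff (Q t0) k * - L t0 (pCons 0 (pCons 0 (monom 1 k * B))))
     = (\<Sum>k\<le>N. d k * L t0 (monom 1 k * B)) - L t0 (pCons 0 (pCons 0 (Q t0 * B)))"
    using expand[OF \<open>t0 > 0\<close>, of "\<lambda>p. L t0 ([:0, 0, 1:] * p * B)"]
    by (simp add: L_sum L_linear sum_distrib_left sum_distrib_right sum_subtractf
        flip: smult_pCons)
  ultimately have "((\<lambda>t. \<Sum>k\<le>N. coeff (Q t) k * L t (monom 1 k * B)) has_real_derivative
      (\<Sum>k\<le>N. d k * L t0 (monom 1 k * B)) - L t0 (pCons 0 (pCons 0 (Q t0 * B)))) (at t0)"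
    by simp
  then show ?thesis
  proof (rule DERIV_transform_pos)
    show "(\<Sum>k\<le>N. coeff (Q t) k * L t (monom 1 k * B)) = L t (Q t * B)" if "t > 0" for t
      using expand[of t "\<lambda>p. L t (p * B)"] that by (simp add: L_sum L_linear sum_distrib_right)
  qed (use \<open>t0 > 0\<close> in auto)
qed

text \<open>The derivative of \<open>P\<^sub>n\<close> with respect to the parameter has degree below \<open>n\<close>, so only the
  derivative of the weight contributes. Freezing one factor \<open>P\<^sub>n\<close> at \<open>t0\<close> does not change \<open>h\<close>,
  because \<open>P\<^sub>n\<close> is monic.\<close>

lemma h_deriv:
  assumes "t0 > 0" and "\<And>k. \<exists>d. ((\<lambda>t. coeff (P t n) k) has_real_derivative d) (at t0)"
  shows "(h n has_real_derivative - (\<gamma> n t0 + \<gamma> (Suc n) t0) * h n t0) (at t0)"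
proof -
  obtain d where d: "\<And>k. ((\<lambda>t. coeff (P t n) k) has_real_derivative d k) (at t0)"
    using assms(2) by metis
  \<comment> \<open>The leading coefficient is constantly 1 for positive \<open>t\<close>.\<close>
  have "((\<lambda>t. 1) has_real_derivative d n) (at t0)"
    by (rule DERIV_transform_pos[OF d assms(1)]) auto
  then have "d n = 0"
    using DERIV_unique DERIV_const by blast
  moreover have "L t0 (monom 1 k * P t0 n) = 0" if "k < n" for k
    using L_P_low[OF assms(1), of "Suc k" "monom 1 k" n] that by (simp add: mult.commute)
  ultimately have "(\<Sum>k\<le>n. d k * L t0 (monom 1 k * P t0 n)) = 0"
    by (intro sum.neutral) (auto simp: le_less)
  moreover have "L t0 (pCons 0 (pCons 0 (P t0 n * P t0 n))) = (\<gamma> n t0 + \<gamma> (Suc n) t0) * h n t0"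
    using L_P_x2P[OF assms(1), of n] by simp
  ultimately have "((\<lambda>t. L t (P t n * P t0 n)) has_real_derivative
      - (\<gamma> n t0 + \<gamma> (Suc n) t0) * h n t0) (at t0)"
    using L_has_real_derivative[of t0 n "\<lambda>t. P t n" d "P t0 n"] d assms(1)
    by (simp add: algebra_simps)
  then show ?thesis
  proof (rule DERIV_transform_pos)
    show "L t (P t n * P t0 n) = h n t" if "t > 0" for t
      using that assms(1) L_P_coeff[of t n "P t0 n"] by (auto simp: coeff_P_gt)
  qed (use \<open>t0 > 0\<close> in auto)
qed

text \<open>The coefficient is h_{n+1} / h_n, so its logarithmic derivative is a difference of two
  instances of \<open>h_deriv\<close>. Differentiability of the polynomials remains a premise
  because the induction that proves it uses this lemma.\<close>

lemma \<gamma>_Suc_deriv_aux: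
  assumes "t0 > 0"
    and n: "\<And>k. \<exists>d. ((\<lambda>t. coeff (P t n) k) has_real_derivative d) (at t0)"
    and Suc_n: "\<And>k. \<exists>d. ((\<lambda>t. coeff (P t (Suc n)) k) has_real_derivative d) (at t0)"
  shows "(\<gamma> (Suc n) has_real_derivative \<gamma> (Suc n) t0 * (\<gamma> n t0 - \<gamma> (Suc (Suc n)) t0)) (at t0)"
proof -
  have "((\<lambda>t. h (Suc n) t / h n t) has_real_derivative
      \<gamma> (Suc n) t0 * (\<gamma> n t0 - \<gamma> (Suc (Suc n)) t0)) (at t0)"
    using h_pos[OF assms(1), of n] h_Suc[OF assms(1), of n]
    by (auto intro!: derivative_eq_intros h_deriv[OF assms(1)] n Suc_n simp: field_simps)
  then show ?thesis
  proof (rule DERIV_transform_pos)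
    show "h (Suc n) t / h n t = \<gamma> (Suc n) t" if "t > 0" for t
      using that h_pos[of t n] h_Suc[of t n] by simp
  qed (use \<open>t0 > 0\<close> in auto)
qed

text \<open>The induction carries two consecutive indices: P_n and P_{n+1} make
  \<open>\<gamma> (Suc n)\<close> differentiable, and the recurrence then passes this on to
  P_{n+2}.\<close>

lemma coeff_P_differentiable:
  assumes "t0 > 0"
  shows "\<exists>d. ((\<lambda>t. coeff (P t n) k) has_real_derivative d) (at t0)"
proof -
  have "(\<forall>k. \<exists>d. ((\<lambda>t. coeff (P t n) k) has_real_derivative d) (at t0))
    \<and> (\<forall>k. \<exists>d. ((\<lambda>t. coeff (P t (Suc n)) k) has_real_derivative d) (at t0))"
  proof (induction n)
    case 0
    have 0: "coeff (P t 0) k = (if k = 0 then 1 else 0)" if "t > 0" for t k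
      using that by (auto simp: coeff_P_gt)
    then have 1: "coeff (P t (Suc 0)) k = (if k = 1 then 1 else 0)" if "t > 0" for t k
      using x_P_0[OF that, symmetric] that by (simp add: coeff_pCons split: nat.split)
    show ?case
      by (intro conjI allI; rule exI; rule DERIV_transform_pos[OF DERIV_const assms])
        (erule 0[symmetric] 1[symmetric])+
  next
    case (Suc n)
    have "\<exists>d. ((\<lambda>t. coeff (P t (Suc (Suc n))) k) has_real_derivative d) (at t0)" for k
    proof -
      obtain d1 where d1: "((\<lambda>t. coeff (P t n) k) has_real_derivative d1) (at t0)"
        using Suc.IH by blast
      obtain d2 where
        d2: "((\<lambda>t. coeff (pCons 0 (P t (Suc n))) k) has_real_derivative d2) (at t0)"
      proof (cases k)
        case 0
        then show ?thesis using that[of 0] by simp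
      next
        case (Suc j)
        then show ?thesis using that Suc.IH by auto
      qed
      have "(\<gamma> (Suc n) has_real_derivative \<gamma> (Suc n) t0 * (\<gamma> n t0 - \<gamma> (Suc (Suc n)) t0)) (at t0)"
        using Suc.IH by (intro \<gamma>_Suc_deriv_aux assms) auto
      from DERIV_diff[OF d2 DERIV_mult[OF this d1]] assms show ?thesis
        by (intro exI) (rule DERIV_transform_pos, assumption+, simp add: x_P_Suc)
    qed
    then show ?case using Suc.IH by blast
  qed
  then show ?thesis by blast
qed

lemma \<gamma>_Suc_deriv:
  "t > 0 \<Longrightarrow>
    (\<gamma> (Suc n) has_real_derivative \<gamma> (Suc n) t * (\<gamma> n t - \<gamma> (Suc (Suc n)) t)) (at t)"
  by (intro \<gamma>_Suc_deriv_aux coeff_P_differentiable)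

lemma \<gamma>_0_deriv: "t > 0 \<Longrightarrow> (\<gamma> 0 has_real_derivative 0) (at t)"
  by (rule DERIV_transform_pos[OF DERIV_const]) auto

text \<open>The Volterra equation brings in the outer neighbours \<gamma>_{n-1} and \<gamma>_{n+2};
  the recurrence for \<open>R\<close> eliminates them.\<close>

lemma R_deriv:
  assumes t: "t > 0"
  shows "(R n has_real_derivative (\<gamma> (Suc n) t - \<gamma> n t) * (R n t + 2 * t) - 1) (at t)"
proof (cases n)
  case 0
  have "(R n has_real_derivative - 2 * \<gamma> 1 t - 2 * t * (\<gamma> 1 t * (0 - \<gamma> 2 t))) (at t)"
    unfolding R_def 0 using t \<gamma>_Suc_deriv[of t 0]
    by (auto intro!: derivative_eq_intros \<gamma>_0_deriv simp: algebra_simps numeral_2_eq_2)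
  moreover have "- 2 * \<gamma> 1 t - 2 * t * (\<gamma> 1 t * (0 - \<gamma> 2 t))
    = (\<gamma> (Suc n) t - \<gamma> n t) * (R n t + 2 * t) - 1"
    using R_rec_0[OF t] t by (simp add: 0 R_def algebra_simps numeral_2_eq_2)
  ultimately show ?thesis by simp
next
  case (Suc m)
  have "(R n has_real_derivative - 2 * (\<gamma> n t + \<gamma> (Suc n) t)
      - 2 * t * (\<gamma> n t * (\<gamma> m t - \<gamma> (Suc n) t) + \<gamma> (Suc n) t * (\<gamma> n t - \<gamma> (Suc (Suc n)) t))) (at t)"
    unfolding R_def Suc
    by (auto intro!: derivative_eq_intros \<gamma>_Suc_deriv t simp: algebra_simps)
  moreover have "- 2 * (\<gamma> n t + \<gamma> (Suc n) t)
      - 2 * t * (\<gamma> n t * (\<gamma> m t - \<gamma> (Suc n) t) + \<gamma> (Suc n) t * (\<gamma> n t - \<gamma> (Suc (Suc n)) t))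
    = (\<gamma> (Suc n) t - \<gamma> n t) * (R n t + 2 * t) - 1"
    using R_rec[OF t, of m] unfolding Suc R_def by (simp add: algebra_simps)
  ultimately show ?thesis by simp
qed

section \<open>First and second derivatives of \<open>g\<close>\<close>

lemma g_Suc_deriv:
  assumes t: "t > 0"
  shows "(g_fun lam \<gamma> (Suc m) has_real_derivative
    - \<gamma> (Suc m) t * (R (Suc m) t - R m t) / 2) (at t)"
  \<comment> \<open>Here \<open>R (Suc m) t - R m t = 2 + 2 * t * (\<gamma> m t - \<gamma> (Suc (Suc
    m)) t)\<close>.\<close>
  unfolding g_fun_def
  by (auto intro!: derivative_eq_intros \<gamma>_Suc_deriv t simp: R_def algebra_simps)

lemma g_Suc_deriv2:
  assumes t: "t > 0"
  shows "(deriv (g_fun lam \<gamma> (Suc m)) has_real_derivative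
    - (\<gamma> (Suc m) t * (\<gamma> m t - \<gamma> (Suc (Suc m)) t) * (R (Suc m) t - R m t)
      + \<gamma> (Suc m) t * ((\<gamma> (Suc (Suc m)) t - \<gamma> (Suc m) t) * (R (Suc m) t + 2 * t)
        - (\<gamma> (Suc m) t - \<gamma> m t) * (R m t + 2 * t))) / 2) (at t)"
proof (rule DERIV_transform_pos)
  show "((\<lambda>t. - \<gamma> (Suc m) t * (R (Suc m) t - R m t) / 2) has_real_derivative
    - (\<gamma> (Suc m) t * (\<gamma> m t - \<gamma> (Suc (Suc m)) t) * (R (Suc m) t - R m t)
      + \<gamma> (Suc m) t * ((\<gamma> (Suc (Suc m)) t - \<gamma> (Suc m) t) * (R (Suc m) t + 2 * t)
        - (\<gamma> (Suc m) t - \<gamma> m t) * (R m t + 2 * t))) / 2) (at t)"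
    by (auto intro!: derivative_eq_intros \<gamma>_Suc_deriv R_deriv t simp: field_simps)
  show "- \<gamma> (Suc m) u * (R (Suc m) u - R m u) / 2 = deriv (g_fun lam \<gamma> (Suc m)) u"
    if "u > 0" for u
    using DERIV_imp_deriv[OF g_Suc_deriv[of u m]] that by simp
qed (use t in auto)

lemma g_0_deriv: "t > 0 \<Longrightarrow> (g_fun lam \<gamma> 0 has_real_derivative 0) (at t)"
  unfolding g_fun_def by (auto intro!: derivative_eq_intros \<gamma>_0_deriv)

lemma g_0_deriv2:
  assumes "t > 0"
  shows "(deriv (g_fun lam \<gamma> 0) has_real_derivative 0) (at t)"
  by (rule DERIV_transform_pos[OF DERIV_const])
    (use assms DERIV_imp_deriv[OF g_0_deriv] in auto)

end

subsection \<open>The differential equation\<close>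

text \<open>Rests on (S - T)^2 + 4 S T = (S + T)^2. Here \<open>c\<close>, \<open>S\<close>,
  \<open>T\<close>, \<open>A\<close> stand for \<gamma>_n, R_n, R_{n-1}, 2 g_n - z.\<close>

lemma lhs_eq_square:
  fixes z A c S T :: real
  assumes "z > 0"
  shows "2 / z * A\<^sup>2 * (2 * z * c * (c * S * T) + 2 * z * (- c * (S - T) / 2)\<^sup>2) = (A * (c * (S + T)))\<^sup>2"
proof -
  have eq: "2 * z * c * (c * S * T) + 2 * z * (- c * (S - T) / 2)\<^sup>2 = z * (c * (S + T))\<^sup>2 / 2"
    by (simp add: power2_eq_square field_simps)
  show ?thesis
    unfolding eq using assms by (simp add: power_mult_distrib)
qed

text \<open>With \<open>p\<close> and \<open>q\<close> for \<gamma>_{n-1} and \<gamma>_{n+1}: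
  multiplied by \<open>z\<close>, the differences of \<open>p\<close>, \<open>c\<close>,
  \<open>q\<close> are affine in \<open>S\<close>, \<open>T\<close>, \<open>g\<close>, so
  \<open>p\<close> and \<open>q\<close> drop out.\<close>

lemma rhs_root:
  fixes z g c S T n lam p q :: real
  assumes g: "g = n / 2 + lam / 2 - 1/4 - z * c"
    and S: "S = 2 * n + 2 * lam - 2 * z * (c + q)"
    and T: "T = 2 * n - 2 + 2 * lam - 2 * z * (p + c)"
    and ST: "4 * g\<^sup>2 - (lam - 1/2)\<^sup>2 = c * S * T"
  shows "4 * g * (3 * g - n - lam + 1/2) - (lam - 1/2)\<^sup>2
    - 2 * z * (- (c * (p - q) * (S - T) + c * ((q - c) * (S + 2 * z) - (c - p) * (T + 2 * z))) / 2)
    - (- c * (S - T) / 2) = (2 * g - z) * (c * (S + T))"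
proof -
  \<comment> \<open>Split 3g as g + (2g) to isolate 4 g^2, which \<open>ST\<close> replaces.\<close>
  have e1: "4 * g * (3 * g - n - lam + 1/2) - (lam - 1/2)\<^sup>2
      = c * S * T + 4 * g * (2 * g - n - lam + 1/2)"
    unfolding ST[symmetric] by (simp add: power2_eq_square algebra_simps)
  have e2: "2 * z * (- (c * (p - q) * (S - T) + c * ((q - c) * (S + 2 * z) - (c - p) * (T + 2 * z))) / 2)
     = - c * (z * (p - q) * (S - T) + (z * (q - c)) * (S + 2 * z) - (z * (c - p)) * (T + 2 * z))"
    by (simp add: field_simps)
  have e3: "z * (p - q) = (S - T) / 2 - 1" 
    unfolding S T by (simp add: algebra_simps)
  have e4: "z * (q - c) = 2 * g - S / 2 + 1 / 2" "z * (c - p) = T / 2 + 1 / 2 - 2 * g"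
    unfolding S T g by (simp_all add: field_simps)
  have e5: "2 * g - n - lam + 1 / 2 = - 2 * z * c"
    unfolding g by simp
  show ?thesis
    unfolding e1 e2 unfolding e3 e4 e5 by (simp add: field_simps)
qed

theorem theorem6p4:
  fixes lam :: real
    and P :: "real \<Rightarrow> nat \<Rightarrow> real poly"
    and \<gamma> :: "nat \<Rightarrow> real \<Rightarrow> real"
    and g :: "nat \<Rightarrow> real \<Rightarrow> real"
    and n :: nat and z :: real
  assumes "lam > -1/2" and "lam \<noteq> 1/2"
    and "\<And>t. t > 0 \<Longrightarrow> monic_orthogonal lam t (P t)"
    and "\<And>t. t > 0 \<Longrightarrow> recurrence_coeffs (P t) (\<lambda>k. \<gamma> k t)"
    and "g = g_fun lam \<gamma>"
    and "z > 0"
  shows "g n differentiable (at z) \<and> deriv (g n) differentiable (at z) \<and>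
         2 / z * (2 * g n z - z)\<^sup>2 *
           ((real n + lam - 1/2 - 2 * g n z) * (4 * (g n z)\<^sup>2 - (lam - 1/2)\<^sup>2)
             + 2 * z * (deriv (g n) z)\<^sup>2)
         = (4 * g n z * (3 * g n z - real n - lam + 1/2) - (lam - 1/2)\<^sup>2
             - 2 * z * deriv (deriv (g n)) z - deriv (g n) z)\<^sup>2"
proof -
  interpret gegenbauer_recurrence lam P \<gamma>
    by unfold_locales (fact assms)+
  show ?thesis
  proof (cases n)
    \<comment> \<open>There is no R_{n-1} here. As \<gamma>_0 = 0, \<open>g 0\<close> is constant on
      the half-line and both bracketed expressions vanish.\<close>
    case 0
    have g0: "g 0 z = lam / 2 - 1/4"
      using \<open>z > 0\<close> by (simp add: assms(5) g_fun_def)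
    have g': "(g 0 has_real_derivative 0) (at z)" "(deriv (g 0) has_real_derivative 0) (at z)"
      using g_0_deriv g_0_deriv2 \<open>z > 0\<close> by (simp_all add: assms(5))
    have "real 0 + lam - 1/2 - 2 * g 0 z = 0"
      and "4 * g 0 z * (3 * g 0 z - real 0 - lam + 1/2) - (lam - 1/2)\<^sup>2 = 0"
      unfolding g0 by (simp_all add: power2_eq_square field_simps)
    moreover have "deriv (g 0) z = 0" "deriv (deriv (g 0)) z = 0"
      using g' by (auto intro: DERIV_imp_deriv)
    ultimately have "(real 0 + lam - 1/2 - 2 * g 0 z) * (4 * (g 0 z)\<^sup>2 - (lam - 1/2)\<^sup>2)
          + 2 * z * (deriv (g 0) z)\<^sup>2 = 0"
      and "4 * g 0 z * (3 * g 0 z - real 0 - lam + 1/2) - (lam - 1/2)\<^sup>2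
          - 2 * z * deriv (deriv (g 0)) z - deriv (g 0) z = 0"
      by simp_all
    note zero = this
    have "g 0 differentiable (at z)" "deriv (g 0) differentiable (at z)"
      using g' unfolding real_differentiable_def by blast+
    then show ?thesis
      unfolding 0 zero by simp
  next
    case (Suc m)
    define c where "c = \<gamma> n z"
    define p where "p = \<gamma> m z"
    define q where "q = \<gamma> (Suc n) z"
    define S where "S = R n z"
    define T where "T = R m z"
    note defs = c_def[symmetric] p_def[symmetric] q_def[symmetric] S_def[symmetric] T_def[symmetric]
    have g1: "deriv (g n) z = - c * (S - T) / 2"
      using DERIV_imp_deriv[OF g_Suc_deriv[OF \<open>z > 0\<close>, of m]]
      by (simp only: assms(5) defs Suc[symmetric])
    have g2: "deriv (deriv (g n)) z
        = - (c * (p - q) * (S - T) + c * ((q - c) * (S + 2 * z) - (c - p) * (T + 2 * z))) / 2"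
      using DERIV_imp_deriv[OF g_Suc_deriv2[OF \<open>z > 0\<close>, of m]]
      by (simp only: assms(5) defs Suc[symmetric])
    have g: "g n z = real n / 2 + lam / 2 - 1/4 - z * c"
      by (simp add: assms(5) g_fun_def c_def)
    have S: "S = 2 * real n + 2 * lam - 2 * z * (c + q)"
      by (simp add: S_def R_def c_def q_def)
    have T: "T = 2 * real n - 2 + 2 * lam - 2 * z * (p + c)"
      by (simp add: T_def R_def p_def c_def Suc)
    have "c * S * T = (real n - 2 * z * c) * (real n - 2 * z * c + 2 * lam - 1)"
      using R_R[OF \<open>z > 0\<close>, of m] by (simp only: defs Suc[symmetric])
    then have ST: "4 * (g n z)\<^sup>2 - (lam - 1/2)\<^sup>2 = c * S * T"
      by (simp add: g power2_eq_square algebra_simps)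
    have root: "4 * g n z * (3 * g n z - real n - lam + 1/2) - (lam - 1/2)\<^sup>2
        - 2 * z * deriv (deriv (g n)) z - deriv (g n) z = (2 * g n z - z) * (c * (S + T))"
      unfolding g1 g2 by (rule rhs_root[OF g S T ST])
    have gap: "real n + lam - 1/2 - 2 * g n z = 2 * z * c"
      by (simp add: g)
    have "g n differentiable (at z)" "deriv (g n) differentiable (at z)"
      using g_Suc_deriv[OF \<open>z > 0\<close>, of m] g_Suc_deriv2[OF \<open>z > 0\<close>, of m]
      unfolding assms(5) Suc real_differentiable_def by blast+
    moreover have "2 / z * (2 * g n z - z)\<^sup>2 *
           ((real n + lam - 1/2 - 2 * g n z) * (4 * (g n z)\<^sup>2 - (lam - 1/2)\<^sup>2)
             + 2 * z * (deriv (g n) z)\<^sup>2)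
         = (4 * g n z * (3 * g n z - real n - lam + 1/2) - (lam - 1/2)\<^sup>2
             - 2 * z * deriv (deriv (g n)) z - deriv (g n) z)\<^sup>2"
      \<comment> \<open>\<open>root\<close> acts first, while \<open>deriv (g n) z\<close> still
        stands on the right-hand side.\<close>
      unfolding root unfolding gap ST g1 by (rule lhs_eq_square[OF \<open>z > 0\<close>])
    ultimately show ?thesis by blast
  qed
qed
end
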